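(* Let $Q=(Q,\bigvee,\circ,1)$ be a quantale, let $\mathbb{C}$ be a $Q$-category all of whose homs are non-zero (i.e. $\mathbb{C}(x,y)\ne 0$ for all $x,y\in\mathbb{C}_0$), and let $f:\mathbb{C}\to\mathbb{C}$ be any $\varphi$-contraction (for some control function $\varphi:Q\to Q$). If $u,u'\in\mathbb{C}_0$ satisfy $fu\cong u$ and $fu'\cong u'$, then $u\cong u'$.
   Context: A quantale $Q=(Q,\bigvee,\circ,1)$ is a complete lattice with a monoid structure $(Q,\circ,1)$ such that $\circ$ distributes over arbitrary suprema in each variable; $1$ need not be the top element and $\circ$ need not be commutative; $0$ denotes the bottom element. A $Q$-category $\mathbb{C}$ is a set $\mathbb{C}_0$ with a map $\mathbb{C}_0\times\mathbb{C}_0\to Q$, $(x,y)\mapsto\mathbb{C}(x,y)$ (the homs), such that $\mathbb{C}(x,y)\circ\mathbb{C}(y,z)\le\mathbb{C}(x,z)$ and $1\le\mathbb{C}(x,x)$ for all $x,y,z$. Objects $c,c'$ are isomorphic, $c\cong c'$, if $1\le\mathbb{C}(c,c')$ and $1\le\mathbb{C}(c',c)$. Given maps $\varphi:Q\to Q$ and $f:\mathbb{C}_0\to\mathbb{C}_0$, $f$ is a $\varphi$-contraction, and $\varphi$ is a control function for $f$, if: (1) $\varphi(t)\ge t$ for all $t\in Q$; (2) if $\varphi(t)=t$ then $t=0$ or $1\le t$; (3) $\mathbb{C}(fx,fy)\ge\varphi(\mathbb{C}(x,y))$ for all $x,y\in\mathbb{C}_0$. *)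

theory Defs
  imports "HOL-Library.FuncSet"
begin

(* The unit 1 is not required to be top, and multiplication is not required to be commutative. *)
class quantale = complete_lattice + monoid_mult +
  assumes mult_Sup_distrib: "a * Sup B = (SUP b\<in>B. a * b)"
    and Sup_mult_distrib: "Sup B * a = (SUP b\<in>B. b * a)"

locale Q_category =
  fixes Ob :: "'a set"
    and hom :: "'a \<Rightarrow> 'a \<Rightarrow> 'q::quantale"
  assumes hom_comp: "\<lbrakk>x \<in> Ob; y \<in> Ob; z \<in> Ob\<rbrakk> \<Longrightarrow> hom x y * hom y z \<le> hom x z"
    and hom_unit: "x \<in> Ob \<Longrightarrow> 1 \<le> hom x x"

definition isomorphic :: "('a \<Rightarrow> 'a \<Rightarrow> 'q::quantale) \<Rightarrow> 'a \<Rightarrow> 'a \<Rightarrow> bool"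
  where "isomorphic hom c c' \<longleftrightarrow> 1 \<le> hom c c' \<and> 1 \<le> hom c' c"

(* Zero is the bottom element bot. *)
definition contraction ::
    "'a set \<Rightarrow> ('a \<Rightarrow> 'a \<Rightarrow> 'q::quantale) \<Rightarrow> ('q \<Rightarrow> 'q) \<Rightarrow> ('a \<Rightarrow> 'a) \<Rightarrow> bool"
  where "contraction Ob hom \<phi> f \<longleftrightarrow>
    f \<in> Ob \<rightarrow> Ob \<and>
    (\<forall>t. t \<le> \<phi> t) \<and>
    (\<forall>t. \<phi> t = t \<longrightarrow> t = bot \<or> 1 \<le> t) \<and>
    (\<forall>x\<in>Ob. \<forall>y\<in>Ob. \<phi> (hom x y) \<le> hom (f x) (f y))"

end

theory Submission
  imports Defs
begin

text \<open>Replacing both arguments of a hom by isomorphic objects does not change its value, so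
  \<open>hom (f u) (f u') \<le> hom u u'\<close> whenever \<open>u\<close> and \<open>u'\<close> are fixed by \<open>f\<close> up to isomorphism. The
  contraction inequality then squeezes
  \<open>hom u u' \<le> \<phi> (hom u u') \<le> hom (f u) (f u') \<le> hom u u'\<close>,
  so \<open>hom u u'\<close> is a fixed point of \<open>\<phi>\<close>. Being non-zero, it lies above \<open>1\<close>, and the same
  argument applies to \<open>hom u' u\<close>.\<close>

text \<open>For \<open>a \<le> b\<close> the join of \<open>{a, b}\<close> is \<open>b\<close>, so distributivity over this join
  exhibits the product with \<open>b\<close> as a join that has the product with \<open>a\<close> among its members.\<close>

lemma quantale_mult_left_mono:
  fixes a b c :: "'q::quantale"
  assumes "a \<le> b"
  shows "c * a \<le> c * b"
  using mult_Sup_distrib[of c "{a, b}"] assms by (simp add: sup_absorb2 le_iff_sup)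

lemma quantale_mult_right_mono:
  fixes a b c :: "'q::quantale"
  assumes "a \<le> b"
  shows "a * c \<le> b * c"
  using Sup_mult_distrib[of "{a, b}" c] assms by (simp add: sup_absorb2 le_iff_sup)

text \<open>Composing with a hom above \<open>1\<close> on either side can only enlarge a hom, by monotonicity of
  multiplication and the unit law.\<close>

lemma (in Q_category) hom_le_hom_of_unit_le:
  assumes "x \<in> Ob" "x' \<in> Ob" "y \<in> Ob" "y' \<in> Ob"
    and "1 \<le> hom x x'" and "1 \<le> hom y' y"
  shows "hom x' y' \<le> hom x y"
proof -
  have "hom x' y' \<le> hom x x' * hom x' y'"
    using quantale_mult_right_mono[OF \<open>1 \<le> hom x x'\<close>, of "hom x' y'"] by simp
  also have "\<dots> \<le> hom x y'"
    using assms by (intro hom_comp)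
  also have "\<dots> \<le> hom x y' * hom y' y"
    using quantale_mult_left_mono[OF \<open>1 \<le> hom y' y\<close>, of "hom x y'"] by simp
  also have "\<dots> \<le> hom x y"
    using assms by (intro hom_comp)
  finally show ?thesis .
qed

text \<open>One half of the isomorphism, stated separately because the situation is symmetric in the two
  fixed points.\<close>

lemma (in Q_category) unit_le_hom_of_contraction_fixpoints:
  assumes "contraction Ob hom \<phi> f" and "u \<in> Ob" and "u' \<in> Ob"
    and "hom u u' \<noteq> bot"
    and "isomorphic hom (f u) u" and "isomorphic hom (f u') u'"
  shows "1 \<le> hom u u'"
proof -
  have "f u \<in> Ob" "f u' \<in> Ob"
    using assms by (auto simp: contraction_def)
  have "\<phi> (hom u u') \<le> hom (f u) (f u')"
    using assms by (simp add: contraction_def)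
  also have "\<dots> \<le> hom u u'"
    using assms \<open>f u \<in> Ob\<close> \<open>f u' \<in> Ob\<close>
    by (intro hom_le_hom_of_unit_le) (simp_all add: isomorphic_def)
  finally have "\<phi> (hom u u') = hom u u'"
    using assms(1) by (intro antisym) (simp_all add: contraction_def)
  then show ?thesis
    using assms(1,4) by (auto simp: contraction_def)
qed

theorem proposition2p1p3:
  fixes Ob :: "'a set"
    and hom :: "'a \<Rightarrow> 'a \<Rightarrow> 'q::quantale"
    and \<phi> :: "'q \<Rightarrow> 'q"
    and f :: "'a \<Rightarrow> 'a"
    and u u' :: 'a
  assumes "Q_category Ob hom"
    and "\<forall>x\<in>Ob. \<forall>y\<in>Ob. hom x y \<noteq> bot"
    and "contraction Ob hom \<phi> f"
    and "u \<in> Ob" and "u' \<in> Ob"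
    and "isomorphic hom (f u) u" and "isomorphic hom (f u') u'"
  shows "isomorphic hom u u'"
  unfolding isomorphic_def
  using assms by (simp add: Q_category.unit_le_hom_of_contraction_fixpoints[OF assms(1,3)])

end
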